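(* Let $n\ge 3$ and let $\Gamma_\Omega$ be the non-commuting graph on $D_{2n}$, where $\Omega=\Omega_1\cup\Omega_2$ with $\Omega_1=\{r^i : 1\le i\le n\}-Z(D_{2n})$ and $\Omega_2=\{sr^i : 1\le i\le n\}$. Then: 1. The eccentric connectivity polynomial is $$\Xi(\Gamma_\Omega,x)=\begin{cases}n(n-1)x^2+2n(n-1)x, & \text{if } n \text{ is odd};\\ 3n(n-2)x^2, & \text{if } n \text{ is even}.\end{cases}$$ 2. The total eccentricity polynomial is $$\Theta(\Gamma_\Omega,x)=\begin{cases}(n-1)x^2+nx, & \text{if } n \text{ is odd};\\ 2(n-1)x^2, & \text{if } n \text{ is even}.\end{cases}$$
   Context: $D_{2n}=\langle r,s : r^n=s^2=1,\ srs=r^{-1}\rangle$ is the dihedral group of order $2n$, and $Z(D_{2n})$ is its center; note $\Omega=D_{2n}-Z(D_{2n})$. $\Gamma_\Omega$ is the simple undirected graph with vertex set $\Omega$ in which two distinct vertices $x,y$ are adjacent if and only if $xy\neq yx$. For a graph $\Gamma$, $\deg_\Gamma(u)$ is the number of edges incident to $u$, and the eccentricity $ecc(u)$ is the largest distance (length of a shortest path) between $u$ and any other vertex of $\Gamma$. The eccentric connectivity polynomial is $\Xi(\Gamma,x)=\sum_{u\in V(\Gamma)}\deg_\Gamma(u)x^{ecc(u)}$ and the total eccentricity polynomial is $\Theta(\Gamma,x)=\sum_{u\in V(\Gamma)}x^{ecc(u)}$. *)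

theory Defs
  imports "HOL-Algebra.Group" "HOL-Computational_Algebra.Polynomial"
begin

section \<open>Groups given by generators and relations\<close>

datatype 'g letter = Gen 'g | GenInv 'g

fun inv_letter :: "'g letter \<Rightarrow> 'g letter" where
  "inv_letter (Gen x) = GenInv x"
| "inv_letter (GenInv x) = Gen x"

type_synonym 'g word = "'g letter list"

text \<open>A pair (u, v) in R stands for the defining relation u = v. The predicate below is the
  least congruence on words that contains R and in which every letter is cancelled by its
  formal inverse; its classes are the elements of the presented group.\<close>

inductive word_eq :: "('g word \<times> 'g word) set \<Rightarrow> 'g word \<Rightarrow> 'g word \<Rightarrow> bool"
  for R :: "('g word \<times> 'g word) set" where
  relation: "(u, v) \<in> R \<Longrightarrow> word_eq R u v"
| cancel: "word_eq R [a, inv_letter a] []"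
| refl: "word_eq R u u"
| sym: "word_eq R u v \<Longrightarrow> word_eq R v u"
| trans: "word_eq R u v \<Longrightarrow> word_eq R v w \<Longrightarrow> word_eq R u w"
| append: "word_eq R u u' \<Longrightarrow> word_eq R v v' \<Longrightarrow> word_eq R (u @ v) (u' @ v')"

definition word_class :: "('g word \<times> 'g word) set \<Rightarrow> 'g word \<Rightarrow> 'g word set" where
  "word_class R u = {v. word_eq R u v}"

definition presented_group :: "('g word \<times> 'g word) set \<Rightarrow> 'g word set monoid" where
  "presented_group R =
     \<lparr> carrier = range (word_class R),
       monoid.mult = (\<lambda>A B. \<Union>u\<in>A. \<Union>v\<in>B. word_class R (u @ v)),
       one = word_class R [] \<rparr>"

lemma word_class_eq_iff: "word_class R u = word_class R v \<longleftrightarrow> word_eq R u v"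
  unfolding word_class_def by (auto intro: word_eq.intros)

lemma presented_group_mult:
  "word_class R u \<otimes>\<^bsub>presented_group R\<^esub> word_class R v = word_class R (u @ v)"
  unfolding presented_group_def word_class_def
  by (auto intro: word_eq.intros)

lemma word_eq_left_inverse: "word_eq R (rev (map inv_letter u) @ u) []"
proof (induction u)
  case Nil
  show ?case by (simp add: word_eq.refl)
next
  case (Cons a u)
  have "word_eq R [inv_letter a, inv_letter (inv_letter a)] []"
    by (rule word_eq.cancel)
  moreover have "inv_letter (inv_letter a) = a"
    by (cases a) auto
  ultimately have "word_eq R [inv_letter a, a] []"
    by simp
  then have "word_eq R ([inv_letter a, a] @ u) ([] @ u)"
    by (rule word_eq.append[OF _ word_eq.refl])
  then have "word_eq R (rev (map inv_letter u) @ [inv_letter a, a] @ u)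
      (rev (map inv_letter u) @ [] @ u)"
    by (rule word_eq.append[OF word_eq.refl])
  with Cons.IH show ?case
    by (auto intro: word_eq.trans)
qed

lemma group_presented_group: "group (presented_group R)"
proof (rule groupI)
  fix x assume "x \<in> carrier (presented_group R)"
  then obtain u where u: "x = word_class R u"
    by (auto simp: presented_group_def)
  have "word_class R (rev (map inv_letter u)) \<otimes>\<^bsub>presented_group R\<^esub> x = word_class R []"
    using word_eq_left_inverse[of R u]
    by (simp add: u presented_group_mult word_class_eq_iff)
  moreover have "word_class R (rev (map inv_letter u)) \<in> carrier (presented_group R)"
    and "word_class R [] = \<one>\<^bsub>presented_group R\<^esub>"
    by (simp_all add: presented_group_def)
  ultimately show "\<exists>y\<in>carrier (presented_group R).
      y \<otimes>\<^bsub>presented_group R\<^esub> x = \<one>\<^bsub>presented_group R\<^esub>"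
    by metis
next
  fix x assume "x \<in> carrier (presented_group R)"
  then obtain u where u: "x = word_class R u"
    by (auto simp: presented_group_def)
  have "\<one>\<^bsub>presented_group R\<^esub> = word_class R []"
    by (simp add: presented_group_def)
  then show "\<one>\<^bsub>presented_group R\<^esub> \<otimes>\<^bsub>presented_group R\<^esub> x = x"
    by (simp add: u presented_group_mult)
next
  fix x y assume "x \<in> carrier (presented_group R)" "y \<in> carrier (presented_group R)"
  then obtain u v where "x = word_class R u" "y = word_class R v"
    by (auto simp: presented_group_def)
  then have "x \<otimes>\<^bsub>presented_group R\<^esub> y = word_class R (u @ v)"
    by (simp add: presented_group_mult)
  then show "x \<otimes>\<^bsub>presented_group R\<^esub> y \<in> carrier (presented_group R)"
    by (simp add: presented_group_def)
next
  fix x y z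
  assume "x \<in> carrier (presented_group R)" "y \<in> carrier (presented_group R)"
    "z \<in> carrier (presented_group R)"
  then obtain u v w where "x = word_class R u" "y = word_class R v" "z = word_class R w"
    by (auto simp: presented_group_def)
  then show "x \<otimes>\<^bsub>presented_group R\<^esub> y \<otimes>\<^bsub>presented_group R\<^esub> z
      = x \<otimes>\<^bsub>presented_group R\<^esub> (y \<otimes>\<^bsub>presented_group R\<^esub> z)"
    by (simp add: presented_group_mult)
qed (simp add: presented_group_def)


section \<open>The dihedral group\<close>

datatype dihedral_gen = R_gen | S_gen

definition dihedral_relations :: "nat \<Rightarrow> (dihedral_gen word \<times> dihedral_gen word) set" where
  "dihedral_relations n =
     {(replicate n (Gen R_gen), []),
      ([Gen S_gen, Gen S_gen], []),
      ([Gen S_gen, Gen R_gen, Gen S_gen], [GenInv R_gen])}"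

text \<open>The parameter n is half the order: this is the group written \<open>D\<^sub>2\<^sub>n\<close>.\<close>

definition dihedral_group :: "nat \<Rightarrow> dihedral_gen word set monoid" where
  "dihedral_group n = presented_group (dihedral_relations n)"

definition dihedral_r :: "nat \<Rightarrow> dihedral_gen word set" where
  "dihedral_r n = word_class (dihedral_relations n) [Gen R_gen]"

definition dihedral_s :: "nat \<Rightarrow> dihedral_gen word set" where
  "dihedral_s n = word_class (dihedral_relations n) [Gen S_gen]"

definition group_center :: "('a, 'b) monoid_scheme \<Rightarrow> 'a set" where
  "group_center G = {z \<in> carrier G. \<forall>g \<in> carrier G. z \<otimes>\<^bsub>G\<^esub> g = g \<otimes>\<^bsub>G\<^esub> z}"

definition dihedral_Omega :: "nat \<Rightarrow> dihedral_gen word set set" where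
  "dihedral_Omega n = carrier (dihedral_group n) - group_center (dihedral_group n)"

definition dihedral_Omega1 :: "nat \<Rightarrow> dihedral_gen word set set" where
  "dihedral_Omega1 n =
     {dihedral_r n [^]\<^bsub>dihedral_group n\<^esub> i |i::nat. 1 \<le> i \<and> i \<le> n} - group_center (dihedral_group n)"

definition dihedral_Omega2 :: "nat \<Rightarrow> dihedral_gen word set set" where
  "dihedral_Omega2 n =
     {dihedral_s n \<otimes>\<^bsub>dihedral_group n\<^esub> (dihedral_r n [^]\<^bsub>dihedral_group n\<^esub> i) |i::nat. 1 \<le> i \<and> i \<le> n}"


section \<open>Graphs, eccentricity and the two polynomials\<close>

text \<open>Edges are two-element sets of vertices.\<close>

record 'a ugraph =
  vertices :: "'a set"
  edges :: "'a set set"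

definition noncommuting_graph :: "('a, 'b) monoid_scheme \<Rightarrow> 'a set \<Rightarrow> 'a ugraph" where
  "noncommuting_graph G A =
     \<lparr> vertices = A,
       edges = {{x, y} |x y. x \<in> A \<and> y \<in> A \<and> x \<noteq> y \<and> x \<otimes>\<^bsub>G\<^esub> y \<noteq> y \<otimes>\<^bsub>G\<^esub> x} \<rparr>"

definition degree_at :: "'a ugraph \<Rightarrow> 'a \<Rightarrow> nat" where
  "degree_at \<Gamma> u = card {e \<in> edges \<Gamma>. u \<in> e}"

definition is_path :: "'a ugraph \<Rightarrow> 'a \<Rightarrow> 'a list \<Rightarrow> 'a \<Rightarrow> bool" where
  "is_path \<Gamma> u p v \<longleftrightarrow>
     p \<noteq> [] \<and> hd p = u \<and> last p = v \<and> distinct p \<and> set p \<subseteq> vertices \<Gamma> \<and>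
     successively (\<lambda>x y. {x, y} \<in> edges \<Gamma>) p"

text \<open>The length of a path is its number of edges. The distance is unspecified for vertices
  that no path connects, and the eccentricity is meaningful for finite connected graphs with at
  least two vertices.\<close>

definition distance :: "'a ugraph \<Rightarrow> 'a \<Rightarrow> 'a \<Rightarrow> nat" where
  "distance \<Gamma> u v = (LEAST k. \<exists>p. is_path \<Gamma> u p v \<and> k = length p - 1)"

definition eccentricity :: "'a ugraph \<Rightarrow> 'a \<Rightarrow> nat" where
  "eccentricity \<Gamma> u = Max (distance \<Gamma> u ` (vertices \<Gamma> - {u}))"

definition eccentric_connectivity_poly :: "'a ugraph \<Rightarrow> int poly" where
  "eccentric_connectivity_poly \<Gamma> =
     (\<Sum>u\<in>vertices \<Gamma>. monom (int (degree_at \<Gamma> u)) (eccentricity \<Gamma> u))"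

definition total_eccentricity_poly :: "'a ugraph \<Rightarrow> int poly" where
  "total_eccentricity_poly \<Gamma> = (\<Sum>u\<in>vertices \<Gamma>. monom 1 (eccentricity \<Gamma> u))"

end

theory Submission
  imports Defs "HOL-Number_Theory.Cong"
begin

text \<open>
  Every element of the dihedral group of order \<open>2n\<close> is \<open>s\<^sup>b r\<^sup>i\<close> for a unique bit \<open>b\<close> and a unique
  residue \<open>i\<close> modulo \<open>n\<close>. For a group given by generators and relations, existence is a
  computation with the relations (\<open>cls_eq_elt\<close>), but uniqueness needs a model in which the
  relations hold and the normal forms differ. The model is the multiplication
  \<open>(b, i)(c, j) = (b + c, (-1)\<^sup>c i + j)\<close> on bits and integers: the value of a word in it, with the
  integer read modulo \<open>n\<close>, depends only on the class of the word (\<open>word_eq_imp_word_val\<close>), which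
  gives \<open>elt_eq_iff\<close>.

  In normal form, commutation becomes divisibility. Rotations commute with each other,
  \<open>r\<^sup>i\<close> commutes with a reflection iff \<open>n\<close> divides \<open>2i\<close>, and \<open>sr\<^sup>i\<close> commutes with \<open>sr\<^sup>j\<close> iff \<open>n\<close>
  divides \<open>2(j - i)\<close>. The congruence \<open>2k = 0\<close> modulo \<open>n\<close> has \<open>c\<close> solutions, with \<open>c = 1\<close> for odd
  \<open>n\<close> and \<open>c = 2\<close> for even \<open>n\<close>, and this one number governs the whole graph:

  \<^item> The center consists of \<open>c\<close> rotations, so there are \<open>n - c\<close> noncentral rotations. Each is adjacent
    to exactly the \<open>n\<close> reflections. It is not adjacent to its inverse, from which it
    differs, and a reflection joins the two; its eccentricity is 2.

  \<^item> Each of the \<open>n\<close> reflections is adjacent to all \<open>n - c\<close> noncentral rotations and to \<open>n - c\<close>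
    reflections. For odd \<open>n\<close> these are all other vertices and the eccentricity is 1. For even \<open>n\<close>
    exactly one other reflection is missed, and the rotation \<open>r\<close> joins the two, so the
    eccentricity is 2. In both cases it equals \<open>c\<close>.

  Hence the eccentric connectivity polynomial is \<open>(n - c) n x\<^sup>2 + 2 n (n - c) x\<^sup>c\<close> and the total
  eccentricity polynomial is \<open>(n - c) x\<^sup>2 + n x\<^sup>c\<close>.
\<close>

section \<open>Distances and degrees in graphs\<close>

lemma distance_eq_1:
  assumes "u \<noteq> v" "u \<in> vertices \<Gamma>" "v \<in> vertices \<Gamma>" "{u, v} \<in> edges \<Gamma>"
  shows "distance \<Gamma> u v = 1"
  unfolding distance_def
proof (rule Least_equality)
  have "is_path \<Gamma> u [u, v] v"
    using assms by (simp add: is_path_def)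
  then show "\<exists>p. is_path \<Gamma> u p v \<and> 1 = length p - 1"
    by (intro exI[of _ "[u, v]"]) simp
next
  fix k assume "\<exists>p. is_path \<Gamma> u p v \<and> k = length p - 1"
  then obtain p where p: "is_path \<Gamma> u p v" "k = length p - 1"
    by blast
  show "1 \<le> k"
    using p assms(1) by (cases p rule: remdups_adj.cases) (auto simp: is_path_def)
qed

lemma distance_eq_2:
  assumes "u \<noteq> v" "{u, v} \<notin> edges \<Gamma>" "u \<in> vertices \<Gamma>" "v \<in> vertices \<Gamma>"
    and "w \<in> vertices \<Gamma>" "w \<noteq> u" "w \<noteq> v" "{u, w} \<in> edges \<Gamma>" "{w, v} \<in> edges \<Gamma>"
  shows "distance \<Gamma> u v = 2"
  unfolding distance_def
proof (rule Least_equality)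
  have "is_path \<Gamma> u [u, w, v] v"
    using assms by (simp add: is_path_def)
  then show "\<exists>p. is_path \<Gamma> u p v \<and> 2 = length p - 1"
    by (intro exI[of _ "[u, w, v]"]) simp
next
  fix k assume "\<exists>p. is_path \<Gamma> u p v \<and> k = length p - 1"
  then obtain p where p: "is_path \<Gamma> u p v" "k = length p - 1"
    by blast
  show "2 \<le> k"
  proof (cases p rule: remdups_adj.cases)
    case (3 x y zs)
    then show ?thesis
      using p assms(1,2) by (cases zs) (auto simp: is_path_def)
  qed (use p assms(1) in \<open>auto simp: is_path_def\<close>)
qed

text \<open>The condition that the end points differ disappears, because every element commutes with
  itself.\<close>

lemma noncommuting_edge_iff:
  "{u, v} \<in> edges (noncommuting_graph G A) \<longleftrightarrow>
     u \<in> A \<and> v \<in> A \<and> u \<otimes>\<^bsub>G\<^esub> v \<noteq> v \<otimes>\<^bsub>G\<^esub> u"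
  unfolding noncommuting_graph_def by (auto simp: doubleton_eq_iff)

lemma vertices_noncommuting_graph [simp]: "vertices (noncommuting_graph G A) = A"
  by (simp add: noncommuting_graph_def)

text \<open>Mapping each neighbour \<open>v\<close> of \<open>u\<close> to the edge \<open>{u, v}\<close> is a bijection, so edges can be counted
  by their other end points.\<close>

lemma degree_noncommuting_graph:
  assumes "u \<in> A"
  shows "degree_at (noncommuting_graph G A) u = card {v \<in> A. u \<otimes>\<^bsub>G\<^esub> v \<noteq> v \<otimes>\<^bsub>G\<^esub> u}"
proof -
  have "{e \<in> edges (noncommuting_graph G A). u \<in> e} =
      (\<lambda>v. {u, v}) ` {v \<in> A. u \<otimes>\<^bsub>G\<^esub> v \<noteq> v \<otimes>\<^bsub>G\<^esub> u}"
    using assms unfolding noncommuting_graph_def by auto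
  moreover have "inj_on (\<lambda>v. {u, v}) B" for B
    by (auto simp: inj_on_def doubleton_eq_iff)
  ultimately show ?thesis
    by (simp add: degree_at_def card_image)
qed

lemma eccentricity_noncommuting_graph_eq_1:
  assumes "u \<in> A" "A \<noteq> {u}"
    and adj: "\<And>v. v \<in> A \<Longrightarrow> v \<noteq> u \<Longrightarrow> u \<otimes>\<^bsub>G\<^esub> v \<noteq> v \<otimes>\<^bsub>G\<^esub> u"
  shows "eccentricity (noncommuting_graph G A) u = 1"
proof -
  have "distance (noncommuting_graph G A) u v = 1" if "v \<in> A - {u}" for v
    using that assms(1) adj by (intro distance_eq_1) (auto simp: noncommuting_edge_iff)
  then have "distance (noncommuting_graph G A) u ` (A - {u}) = {1}"
    using assms(1,2) by auto
  then show ?thesis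
    by (simp add: eccentricity_def)
qed

lemma eccentricity_noncommuting_graph_eq_2:
  assumes "u \<in> A" and v: "v \<in> A" "v \<noteq> u" "u \<otimes>\<^bsub>G\<^esub> v = v \<otimes>\<^bsub>G\<^esub> u"
    and mid: "\<And>v. v \<in> A \<Longrightarrow> u \<otimes>\<^bsub>G\<^esub> v = v \<otimes>\<^bsub>G\<^esub> u \<Longrightarrow>
      \<exists>w\<in>A. u \<otimes>\<^bsub>G\<^esub> w \<noteq> w \<otimes>\<^bsub>G\<^esub> u \<and> w \<otimes>\<^bsub>G\<^esub> v \<noteq> v \<otimes>\<^bsub>G\<^esub> w"
  shows "eccentricity (noncommuting_graph G A) u = 2"
proof -
  let ?d = "distance (noncommuting_graph G A) u"
  have two: "?d v = 2" if v': "v \<in> A" "v \<noteq> u" "u \<otimes>\<^bsub>G\<^esub> v = v \<otimes>\<^bsub>G\<^esub> u" for v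
  proof -
    obtain w where "w \<in> A" "u \<otimes>\<^bsub>G\<^esub> w \<noteq> w \<otimes>\<^bsub>G\<^esub> u" "w \<otimes>\<^bsub>G\<^esub> v \<noteq> v \<otimes>\<^bsub>G\<^esub> w"
      using mid[OF v'(1,3)] by blast
    then show ?thesis
      using v' assms(1) by (intro distance_eq_2[where w = w]) (auto simp: noncommuting_edge_iff)
  qed
  have one: "?d v = 1" if "v \<in> A" "v \<noteq> u" "u \<otimes>\<^bsub>G\<^esub> v \<noteq> v \<otimes>\<^bsub>G\<^esub> u" for v
    using that assms(1) by (intro distance_eq_1) (auto simp: noncommuting_edge_iff)
  have "?d ` (A - {u}) \<subseteq> {1, 2}"
    using one two by blast
  moreover have "2 \<in> ?d ` (A - {u})"
    using two[OF v] v by (metis DiffI imageI singletonD)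
  ultimately have "Max (?d ` (A - {u})) = 2"
    by (intro Max_eqI) (auto intro: finite_subset)
  then show ?thesis
    by (simp add: eccentricity_def)
qed


section \<open>Normal forms in the dihedral group\<close>

text \<open>The pair \<open>(b, i)\<close> stands for \<open>s\<^sup>b r\<^sup>i\<close>, and the product encodes \<open>r\<^sup>i s = s r\<^sup>-\<^sup>i\<close>. The exponents are
  integers, so this is the infinite dihedral group; they are compared modulo \<open>n\<close>
  only afterwards, which keeps the product a plain formula.\<close>

fun dihedral_mult :: "bool \<times> int \<Rightarrow> bool \<times> int \<Rightarrow> bool \<times> int" where
  "dihedral_mult (b, i) (c, j) = (b \<noteq> c, (if c then - i else i) + j)"

fun letter_val :: "dihedral_gen letter \<Rightarrow> bool \<times> int" where
  "letter_val (Gen R_gen) = (False, 1)"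
| "letter_val (GenInv R_gen) = (False, -1)"
| "letter_val (Gen S_gen) = (True, 0)"
| "letter_val (GenInv S_gen) = (True, 0)"

primrec word_val :: "dihedral_gen word \<Rightarrow> bool \<times> int" where
  "word_val [] = (False, 0)"
| "word_val (a # w) = dihedral_mult (letter_val a) (word_val w)"

lemma dihedral_mult_assoc:
  "dihedral_mult (dihedral_mult p q) t = dihedral_mult p (dihedral_mult q t)"
  by (cases p; cases q; cases t) auto

lemma word_val_append: "word_val (u @ v) = dihedral_mult (word_val u) (word_val v)"
proof (induction u)
  case Nil
  show ?case by (cases "word_val v") simp
qed (simp add: dihedral_mult_assoc)

lemma word_val_replicate_R: "word_val (replicate k (Gen R_gen)) = (False, int k)"
  by (induction k) auto

text \<open>Soundness of the model: the defining relations hold in it modulo \<open>n\<close>, and congruence modulo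
  \<open>n\<close> is compatible with its product. This is the only source of inequalities
  between elements of the presented group.\<close>

lemma word_eq_imp_word_val:
  assumes "word_eq (dihedral_relations n) u v"
  shows "fst (word_val u) = fst (word_val v) \<and>
    [snd (word_val u) = snd (word_val v)] (mod int n)"
  using assms
proof induction
  case (relation u v)
  then show ?case
    by (auto simp: dihedral_relations_def word_val_replicate_R cong_def)
next
  case (cancel a)
  show ?case
    by (cases a rule: letter_val.cases) auto
next
  case (append u u' v v')
  then show ?case
    by (cases "word_val u"; cases "word_val u'"; cases "word_val v"; cases "word_val v'")
      (auto simp: word_val_append intro!: cong_add cong_diff)
next
  case (trans u v w)
  then show ?case
    using cong_trans by auto
qed (auto simp: cong_sym_eq)

locale dihedral =
  fixes n :: nat
  assumes n_pos: "n > 0"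
begin

abbreviation G where "G \<equiv> dihedral_group n"
abbreviation r where "r \<equiv> dihedral_r n"
abbreviation s where "s \<equiv> dihedral_s n"

end

sublocale dihedral \<subseteq> group "dihedral_group n"
  unfolding dihedral_group_def by (rule group_presented_group)

context dihedral
begin

abbreviation cls where "cls \<equiv> word_class (dihedral_relations n)"

lemma cls_closed [simp]: "cls w \<in> carrier G"
  by (simp add: dihedral_group_def presented_group_def)

lemma cls_append: "cls (u @ v) = cls u \<otimes>\<^bsub>G\<^esub> cls v"
  by (simp add: dihedral_group_def presented_group_mult)

lemma cls_Nil: "cls [] = \<one>\<^bsub>G\<^esub>"
  by (simp add: dihedral_group_def presented_group_def)

lemma r_closed [simp]: "r \<in> carrier G" and s_closed [simp]: "s \<in> carrier G"
  by (simp_all add: dihedral_r_def dihedral_s_def)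

lemma cls_replicate: "cls (replicate k (Gen R_gen)) = r [^]\<^bsub>G\<^esub> k"
proof (induction k)
  case (Suc k)
  have "cls (replicate (Suc k) (Gen R_gen)) = cls (replicate k (Gen R_gen)) \<otimes>\<^bsub>G\<^esub> r"
    by (simp only: replicate_Suc replicate_append_same[symmetric] cls_append dihedral_r_def)
  with Suc show ?case
    by simp
qed (simp add: cls_Nil)

lemma cls_GenInv: "cls [GenInv x] = inv\<^bsub>G\<^esub> cls [Gen x]"
proof -
  have "word_eq (dihedral_relations n) [GenInv x, inv_letter (GenInv x)] []"
    by (rule word_eq.cancel)
  then have "cls ([GenInv x] @ [Gen x]) = cls []"
    by (simp add: word_class_eq_iff)
  then have "cls [GenInv x] \<otimes>\<^bsub>G\<^esub> cls [Gen x] = \<one>\<^bsub>G\<^esub>"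
    by (simp only: cls_append cls_Nil)
  then show ?thesis
    by (simp add: inv_equality)
qed

lemma cls_relation: "(u, v) \<in> dihedral_relations n \<Longrightarrow> cls u = cls v"
  by (simp add: word_class_eq_iff word_eq.relation)

lemma r_pow_n: "r [^]\<^bsub>G\<^esub> n = \<one>\<^bsub>G\<^esub>"
proof -
  have "cls (replicate n (Gen R_gen)) = cls []"
    by (rule cls_relation) (simp add: dihedral_relations_def)
  then show ?thesis
    by (simp only: cls_replicate cls_Nil)
qed

lemma s_s: "s \<otimes>\<^bsub>G\<^esub> s = \<one>\<^bsub>G\<^esub>"
proof -
  have "cls ([Gen S_gen] @ [Gen S_gen]) = cls []"
    by (rule cls_relation) (simp add: dihedral_relations_def)
  then show ?thesis
    by (simp only: cls_append cls_Nil dihedral_s_def)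
qed

text \<open>The relation \<open>srs = r\<^sup>-\<^sup>1\<close>, multiplied by \<open>s\<close> on the left.\<close>

lemma r_s: "r \<otimes>\<^bsub>G\<^esub> s = s \<otimes>\<^bsub>G\<^esub> inv\<^bsub>G\<^esub> r"
proof -
  have "cls ([Gen S_gen] @ [Gen R_gen] @ [Gen S_gen]) = cls [GenInv R_gen]"
    by (rule cls_relation) (simp add: dihedral_relations_def)
  then have "s \<otimes>\<^bsub>G\<^esub> (r \<otimes>\<^bsub>G\<^esub> s) = inv\<^bsub>G\<^esub> r"
    by (simp only: cls_append cls_GenInv dihedral_s_def dihedral_r_def)
  then have "s \<otimes>\<^bsub>G\<^esub> inv\<^bsub>G\<^esub> r = (s \<otimes>\<^bsub>G\<^esub> s) \<otimes>\<^bsub>G\<^esub> (r \<otimes>\<^bsub>G\<^esub> s)"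
    by (simp add: m_assoc)
  then show ?thesis
    by (simp add: s_s)
qed

lemma r_pow_nat_s: "r [^]\<^bsub>G\<^esub> (k::nat) \<otimes>\<^bsub>G\<^esub> s = s \<otimes>\<^bsub>G\<^esub> inv\<^bsub>G\<^esub> (r [^]\<^bsub>G\<^esub> k)"
proof (induction k)
  case (Suc k)
  have "r [^]\<^bsub>G\<^esub> Suc k \<otimes>\<^bsub>G\<^esub> s = r [^]\<^bsub>G\<^esub> k \<otimes>\<^bsub>G\<^esub> (r \<otimes>\<^bsub>G\<^esub> s)"
    by (simp add: m_assoc)
  also have "\<dots> = (r [^]\<^bsub>G\<^esub> k \<otimes>\<^bsub>G\<^esub> s) \<otimes>\<^bsub>G\<^esub> inv\<^bsub>G\<^esub> r"
    by (simp add: r_s m_assoc)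
  also have "\<dots> = s \<otimes>\<^bsub>G\<^esub> inv\<^bsub>G\<^esub> (r \<otimes>\<^bsub>G\<^esub> r [^]\<^bsub>G\<^esub> k)"
    by (simp add: Suc inv_mult_group m_assoc)
  finally show ?case
    by (metis nat_pow_Suc2 r_closed)
qed simp

lemma r_pow_s: "r [^]\<^bsub>G\<^esub> (i::int) \<otimes>\<^bsub>G\<^esub> s = s \<otimes>\<^bsub>G\<^esub> r [^]\<^bsub>G\<^esub> (- i)"
proof (cases i rule: int_cases2)
  case (nonneg k)
  then show ?thesis
    by (simp add: int_pow_neg int_pow_int r_pow_nat_s)
next
  case (nonpos k)
  \<comment> \<open>The case of natural exponents, multiplied by the inverse power on the left and by the power
    on the right.\<close>
  let ?x = "r [^]\<^bsub>G\<^esub> k"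
  have x: "?x \<in> carrier G" by simp
  have "s \<otimes>\<^bsub>G\<^esub> ?x = inv\<^bsub>G\<^esub> ?x \<otimes>\<^bsub>G\<^esub> (?x \<otimes>\<^bsub>G\<^esub> s) \<otimes>\<^bsub>G\<^esub> ?x"
    by (simp add: m_assoc[symmetric])
  also have "\<dots> = inv\<^bsub>G\<^esub> ?x \<otimes>\<^bsub>G\<^esub> s"
    by (simp only: r_pow_nat_s) (simp add: m_assoc)
  finally show ?thesis
    using nonpos by (simp add: int_pow_neg int_pow_int)
qed

definition elt :: "bool \<times> int \<Rightarrow> dihedral_gen word set" where
  "elt p = (if fst p then s else \<one>\<^bsub>G\<^esub>) \<otimes>\<^bsub>G\<^esub> r [^]\<^bsub>G\<^esub> snd p"

lemma elt_closed [simp]: "elt p \<in> carrier G"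
  by (simp add: elt_def)

text \<open>Moving the power of \<open>r\<close> past the second factor \<open>s\<^sup>c\<close> shows that \<open>elt\<close> is multiplicative; it is the
  projection from the infinite dihedral group.\<close>

lemma elt_mult: "elt p \<otimes>\<^bsub>G\<^esub> elt q = elt (dihedral_mult p q)"
proof -
  obtain b i c j where pq: "p = (b, i)" "q = (c, j)"
    by (cases p, cases q)
  let ?e = "\<lambda>b. if b then s else \<one>\<^bsub>G\<^esub>"
  have e: "?e b \<in> carrier G" for b
    by simp
  have comm: "r [^]\<^bsub>G\<^esub> i \<otimes>\<^bsub>G\<^esub> ?e c = ?e c \<otimes>\<^bsub>G\<^esub> r [^]\<^bsub>G\<^esub> (if c then - i else i)"
    by (simp add: r_pow_s)
  have "elt p \<otimes>\<^bsub>G\<^esub> elt q = ?e b \<otimes>\<^bsub>G\<^esub> (r [^]\<^bsub>G\<^esub> i \<otimes>\<^bsub>G\<^esub> ?e c) \<otimes>\<^bsub>G\<^esub> r [^]\<^bsub>G\<^esub> j"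
    using e by (simp add: elt_def pq m_assoc del: if_split)
  also have "\<dots> = (?e b \<otimes>\<^bsub>G\<^esub> ?e c) \<otimes>\<^bsub>G\<^esub> (r [^]\<^bsub>G\<^esub> (if c then - i else i) \<otimes>\<^bsub>G\<^esub> r [^]\<^bsub>G\<^esub> j)"
    unfolding comm using e by (simp add: m_assoc)
  also have "?e b \<otimes>\<^bsub>G\<^esub> ?e c = ?e (b \<noteq> c)"
    by (simp add: s_s)
  also have "r [^]\<^bsub>G\<^esub> (if c then - i else i) \<otimes>\<^bsub>G\<^esub> r [^]\<^bsub>G\<^esub> j = r [^]\<^bsub>G\<^esub> ((if c then - i else i) + j)"
    by (simp only: int_pow_mult r_closed)
  finally show ?thesis
    by (simp add: elt_def pq)
qed

lemma elt_mod: "elt (b, i mod int n) = elt (b, i)"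
proof -
  have "r [^]\<^bsub>G\<^esub> i = r [^]\<^bsub>G\<^esub> (int n * (i div int n) + i mod int n)"
    by simp
  also have "\<dots> = (r [^]\<^bsub>G\<^esub> int n) [^]\<^bsub>G\<^esub> (i div int n) \<otimes>\<^bsub>G\<^esub> r [^]\<^bsub>G\<^esub> (i mod int n)"
    by (simp only: int_pow_mult int_pow_pow r_closed)
  also have "\<dots> = r [^]\<^bsub>G\<^esub> (i mod int n)"
    by (simp add: int_pow_int r_pow_n)
  finally show ?thesis
    by (simp add: elt_def)
qed

lemma cls_eq_elt: "cls w = elt (word_val w)"
proof (induction w)
  case Nil
  show ?case by (simp add: cls_Nil elt_def)
next
  case (Cons a w)
  have inv_s: "inv\<^bsub>G\<^esub> s = s"
    by (simp add: inv_equality s_s)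
  have "cls [a] = elt (letter_val a)"
    using inv_s
    by (cases a rule: letter_val.cases)
      (simp_all add: elt_def cls_GenInv int_pow_neg flip: dihedral_r_def dihedral_s_def)
  then show ?case
    using cls_append[of "[a]" w] by (simp add: Cons elt_mult)
qed

lemma carrier_eq: "carrier G = range elt"
proof
  have "carrier G = range cls"
    by (simp add: dihedral_group_def presented_group_def)
  then show "carrier G \<subseteq> range elt"
    by (auto simp: cls_eq_elt)
qed auto

text \<open>Uniqueness of normal forms. The soundness lemma speaks about words, so each element is first
  represented by the word \<open>s\<^sup>b r\<^sup>k\<close> with \<open>k\<close> the least nonnegative residue of its exponent.\<close>

lemma elt_eq_iff: "elt (b, i) = elt (c, j) \<longleftrightarrow> b = c \<and> [i = j] (mod int n)"
proof
  define word where "word = (\<lambda>b i. (if b then [Gen S_gen] else []) @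
    replicate (nat (i mod int n)) (Gen R_gen))"
  have val: "word_val (word b i) = (b, i mod int n)" for b i
    using n_pos by (simp add: word_def word_val_append word_val_replicate_R)
  have cls_word: "cls (word b i) = elt (b, i)" for b i
    by (simp add: cls_eq_elt val elt_mod)
  assume "elt (b, i) = elt (c, j)"
  then have "cls (word b i) = cls (word c j)"
    by (simp add: cls_word)
  then show "b = c \<and> [i = j] (mod int n)"
    using word_eq_imp_word_val[of n "word b i" "word c j"]
    by (simp add: word_class_eq_iff val)
next
  assume "b = c \<and> [i = j] (mod int n)"
  then show "elt (b, i) = elt (c, j)"
    using elt_mod[of b i] elt_mod[of c j] by (auto simp: cong_def)
qed


section \<open>Commutation and the center\<close>

abbreviation commute where "commute x y \<equiv> x \<otimes>\<^bsub>G\<^esub> y = y \<otimes>\<^bsub>G\<^esub> x"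

lemma commute_rot_rot: "commute (elt (False, i)) (elt (False, j))"
  by (simp add: elt_mult add.commute)

lemma commute_rot_refl: "commute (elt (False, i)) (elt (True, j)) \<longleftrightarrow> int n dvd 2 * i"
proof -
  have "commute (elt (False, i)) (elt (True, j)) \<longleftrightarrow> int n dvd (j - i) - (j + i)"
    by (simp add: elt_mult elt_eq_iff cong_iff_dvd_diff)
  also have "(j - i) - (j + i) = - (2 * i)"
    by simp
  finally show ?thesis
    by (simp only: dvd_minus_iff)
qed

lemma commute_refl_refl:
  "commute (elt (True, i)) (elt (True, j)) \<longleftrightarrow> int n dvd 2 * (j - i)"
proof -
  have "commute (elt (True, i)) (elt (True, j)) \<longleftrightarrow> int n dvd (j - i) - (i - j)"
    by (simp add: elt_mult elt_eq_iff cong_iff_dvd_diff)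
  also have "(j - i) - (i - j) = 2 * (j - i)"
    by simp
  finally show ?thesis .
qed

text \<open>No reflection is central: it would commute with \<open>r\<close>, which forces \<open>n\<close> to divide 2.\<close>

lemma elt_in_center_iff:
  assumes "n \<ge> 3"
  shows "elt (b, i) \<in> group_center G \<longleftrightarrow> \<not> b \<and> int n dvd 2 * i"
proof (cases b)
  case True
  have "\<not> int n dvd 2 * 1"
    using assms by (auto dest: zdvd_imp_le)
  then have "\<not> commute (elt (True, i)) (elt (False, 1))"
    using commute_rot_refl[of 1 i] by metis
  then show ?thesis
    using True by (auto simp: group_center_def)
next
  case False
  have "elt (False, i) \<in> group_center G \<longleftrightarrow> (\<forall>c j. commute (elt (False, i)) (elt (c, j)))"
    by (auto simp: group_center_def carrier_eq)
  also have "\<dots> \<longleftrightarrow> int n dvd 2 * i"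
    using commute_rot_rot commute_rot_refl by (metis (full_types))
  finally show ?thesis
    using False by simp
qed

definition noncentral_rots :: "dihedral_gen word set set" where
  "noncentral_rots = {elt (False, i) |i. \<not> int n dvd 2 * i}"

definition refls :: "dihedral_gen word set set" where
  "refls = {elt (True, i) |i. True}"

lemma Omega_eq:
  assumes "n \<ge> 3"
  shows "dihedral_Omega n = noncentral_rots \<union> refls"
proof
  show "dihedral_Omega n \<subseteq> noncentral_rots \<union> refls"
  proof
    fix x assume x: "x \<in> dihedral_Omega n"
    then obtain b i where bi: "x = elt (b, i)"
      by (auto simp: dihedral_Omega_def carrier_eq)
    have "b \<or> \<not> int n dvd 2 * i"
      using x elt_in_center_iff[OF assms, of b i] by (simp add: bi dihedral_Omega_def)
    then show "x \<in> noncentral_rots \<union> refls"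
      unfolding bi noncentral_rots_def refls_def by (cases b) auto
  qed
  show "noncentral_rots \<union> refls \<subseteq> dihedral_Omega n"
    by (auto simp: noncentral_rots_def refls_def dihedral_Omega_def elt_in_center_iff[OF assms])
qed

text \<open>The exponents \<open>1, \<dots>, n\<close> form a complete system of residues; \<open>(i - 1) mod n + 1\<close> is the one congruent
  to \<open>i\<close>.\<close>

lemma elt_nat_range: "{elt (b, int i) |i. 1 \<le> i \<and> i \<le> n} = {elt (b, i) |i. True}"
proof
  show "{elt (b, i) |i. True} \<subseteq> {elt (b, int i) |i. 1 \<le> i \<and> i \<le> n}"
  proof clarify
    fix i
    let ?k = "nat ((i - 1) mod int n) + 1"
    have "int ?k = (i - 1) mod int n + 1"
      using n_pos by simp
    then have "[int ?k = i] (mod int n)"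
      by (simp only: cong_def mod_add_left_eq diff_add_cancel)
    moreover have "?k \<le> n"
      using n_pos by (simp add: Suc_le_eq nat_less_iff)
    ultimately show "\<exists>k. elt (b, i) = elt (b, int k) \<and> 1 \<le> k \<and> k \<le> n"
      by (intro exI[of _ ?k]) (auto simp: elt_eq_iff cong_sym_eq)
  qed
qed blast

lemma Omega1_eq:
  assumes "n \<ge> 3"
  shows "dihedral_Omega1 n = noncentral_rots"
proof -
  have "{r [^]\<^bsub>G\<^esub> i |i::nat. 1 \<le> i \<and> i \<le> n} = {elt (False, int i) |i. 1 \<le> i \<and> i \<le> n}"
    by (simp add: elt_def int_pow_int)
  also have "\<dots> = {elt (False, i) |i. True}"
    by (rule elt_nat_range)
  finally show ?thesis
    unfolding dihedral_Omega1_def noncentral_rots_def using elt_in_center_iff[OF assms] by auto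
qed

lemma Omega2_eq: "dihedral_Omega2 n = refls"
proof -
  have "dihedral_Omega2 n = {elt (True, int i) |i. 1 \<le> i \<and> i \<le> n}"
    by (simp add: elt_def int_pow_int dihedral_Omega2_def)
  then show ?thesis
    by (simp only: elt_nat_range refls_def)
qed


section \<open>Counting\<close>

text \<open>The number of residues \<open>k\<close> modulo \<open>n\<close> with \<open>2k = 0\<close>; for \<open>n \<ge> 3\<close> this is the order of the
  center.\<close>

definition center_size :: nat where
  "center_size = (if odd n then 1 else 2)"

text \<open>By uniqueness of normal forms, counting rotations or reflections amounts to counting residues.
  Evaluating \<open>P\<close> at \<open>i mod n\<close> on the left makes the condition periodic for arbitrary \<open>P\<close>.\<close>

lemma card_elt_image: "card {elt (b, i) |i. P (i mod int n)} = card {i \<in> {0..<int n}. P i}"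
proof -
  have "{elt (b, i) |i. P (i mod int n)} = (\<lambda>i. elt (b, i)) ` {i \<in> {0..<int n}. P i}"
  proof
    show "{elt (b, i) |i. P (i mod int n)} \<subseteq> (\<lambda>i. elt (b, i)) ` {i \<in> {0..<int n}. P i}"
    proof clarify
      fix i assume "P (i mod int n)"
      then show "elt (b, i) \<in> (\<lambda>i. elt (b, i)) ` {i \<in> {0..<int n}. P i}"
        using n_pos by (intro image_eqI[of _ _ "i mod int n"]) (auto simp: elt_mod)
    qed
  next
    show "(\<lambda>i. elt (b, i)) ` {i \<in> {0..<int n}. P i} \<subseteq> {elt (b, i) |i. P (i mod int n)}"
      by force
  qed
  moreover have "inj_on (\<lambda>i. elt (b, i)) {i \<in> {0..<int n}. P i}"
    by (auto simp: inj_on_def elt_eq_iff cong_def)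
  ultimately show ?thesis
    by (simp add: card_image)
qed

text \<open>For odd \<open>n\<close> the factor 2 cancels and only \<open>i = j\<close> remains. For \<open>n = 2m\<close> the condition is
  \<open>i = j\<close> modulo \<open>m\<close>, and every residue modulo \<open>m\<close> has two lifts in \<open>{0..<n}\<close>, at distance \<open>m\<close>.\<close>

lemma card_solutions: "card {i \<in> {0..<int n}. int n dvd 2 * (i - j)} = center_size"
proof (cases "odd n")
  case True
  then have "coprime (int n) 2"
    by simp
  then have "int n dvd 2 * (i - j) \<longleftrightarrow> i mod int n = j mod int n" for i
    by (metis cong_def cong_iff_dvd_diff coprime_dvd_mult_right_iff)
  then have "{i \<in> {0..<int n}. int n dvd 2 * (i - j)} = {i \<in> {0..<int n}. i = j mod int n}"
    by (intro Collect_cong conj_cong) simp_all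
  also have "\<dots> = {j mod int n}"
    using n_pos by auto
  finally have "{i \<in> {0..<int n}. int n dvd 2 * (i - j)} = {j mod int n}" .
  then show ?thesis
    using True by (simp add: center_size_def)
next
  case False
  then obtain m where m: "n = 2 * m"
    by blast
  let ?a = "j mod int m"
  have a: "0 \<le> ?a" "?a < int m"
    using m n_pos by auto
  have dvd: "int n dvd 2 * (i - j) \<longleftrightarrow> i mod int m = ?a" for i
    by (simp add: m mod_eq_dvd_iff del: right_diff_distrib_numeral)
  have "i mod int m = (if i < int m then i else i - int m)" if "i \<in> {0..<int n}" for i
  proof (cases "i < int m")
    case False
    then have "i mod int m = (i - int m) mod int m"
      by simp
    also have "\<dots> = i - int m"
      using False that m by (intro mod_pos_pos_trivial) auto
    finally show ?thesis
      using False by simp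
  qed (use that in auto)
  then have "{i \<in> {0..<int n}. int n dvd 2 * (i - j)} =
      {i \<in> {0..<int n}. (if i < int m then i else i - int m) = ?a}"
    using dvd by (intro Collect_cong conj_cong) simp_all
  also have "\<dots> = {?a, ?a + int m}"
    using a m by (auto split: if_splits)
  finally show ?thesis
    using a False by (simp add: center_size_def)
qed

lemma card_nonsolutions: "card {i \<in> {0..<int n}. \<not> int n dvd 2 * (i - j)} = n - center_size"
proof -
  have "{i \<in> {0..<int n}. \<not> int n dvd 2 * (i - j)} =
      {0..<int n} - {i \<in> {0..<int n}. int n dvd 2 * (i - j)}"
    by auto
  also have "card \<dots> = card {0..<int n} - card {i \<in> {0..<int n}. int n dvd 2 * (i - j)}"
    by (rule card_Diff_subset) (auto intro: finite_subset[OF _ finite_atLeastLessThan_int])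
  finally show ?thesis
    by (simp only: card_solutions card_atLeastLessThan_int diff_zero nat_int)
qed

lemma dvd_mod_iff: "int n dvd 2 * (i mod int n - j) \<longleftrightarrow> int n dvd 2 * (i - j)"
proof -
  have "2 * (i mod int n - j) = 2 * (i - j) - int n * (2 * (i div int n))"
    by (simp add: minus_div_mult_eq_mod[symmetric] algebra_simps)
  then show ?thesis
    by (simp only: dvd_diff_left_iff dvd_triv_left)
qed

lemma card_refls: "card refls = n"
proof -
  have "card refls = card {i \<in> {0..<int n}. True}"
    unfolding refls_def by (rule card_elt_image)
  also have "{i \<in> {0..<int n}. True} = {0..<int n}"
    by auto
  finally show ?thesis
    by simp
qed

lemma card_noncentral_rots: "card noncentral_rots = n - center_size"
  using card_elt_image[of False "\<lambda>i. \<not> int n dvd 2 * (i - 0)"]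
  unfolding dvd_mod_iff card_nonsolutions by (simp only: noncentral_rots_def diff_zero)

lemma card_noncommuting_refls:
  "card {elt (True, i) |i. \<not> int n dvd 2 * (i - j)} = n - center_size"
  using card_elt_image[of True "\<lambda>i. \<not> int n dvd 2 * (i - j)"]
  by (simp only: dvd_mod_iff card_nonsolutions)

lemma finite_refls: "finite refls"
  using card_refls n_pos by (metis card.infinite not_less_zero)

lemma rots_refls_disjoint: "noncentral_rots \<inter> refls = {}"
  by (auto simp: noncentral_rots_def refls_def elt_eq_iff)

end


section \<open>The noncommuting graph of the dihedral group\<close>

lemma sum_const_monom: "(\<Sum>u\<in>A. monom c k) = monom (int (card A) * c) k"
  by (induction A rule: infinite_finite_induct) (simp_all add: add_monom distrib_right)

locale dihedral_ge_3 = dihedral +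
  assumes n_ge_3: "n \<ge> 3"
begin

abbreviation \<Gamma> where "\<Gamma> \<equiv> noncommuting_graph G (noncentral_rots \<union> refls)"

lemma finite_noncentral_rots: "finite noncentral_rots"
proof -
  have "card noncentral_rots > 0"
    using n_ge_3 by (simp add: card_noncentral_rots center_size_def)
  then show ?thesis
    by (rule card_ge_0_finite)
qed

lemma r_in_noncentral_rots: "elt (False, 1) \<in> noncentral_rots"
proof -
  have "\<not> int n dvd 2 * 1"
    using n_ge_3 by (auto dest: zdvd_imp_le)
  then show ?thesis
    unfolding noncentral_rots_def by blast
qed

lemma rot_refl_noncommute:
  assumes "x \<in> noncentral_rots" "y \<in> refls"
  shows "\<not> commute x y" "\<not> commute y x"
proof -
  show "\<not> commute x y"
    using assms commute_rot_refl by (auto simp: noncentral_rots_def refls_def)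
  then show "\<not> commute y x"
    by metis
qed

lemma rots_commute: "x \<in> noncentral_rots \<Longrightarrow> y \<in> noncentral_rots \<Longrightarrow> commute x y"
  using commute_rot_rot by (auto simp: noncentral_rots_def)

lemma degree_rot:
  assumes "x \<in> noncentral_rots"
  shows "degree_at \<Gamma> x = n"
proof -
  have "{y \<in> noncentral_rots \<union> refls. \<not> commute x y} = refls"
    using assms rot_refl_noncommute rots_commute by blast
  then show ?thesis
    using assms by (simp add: degree_noncommuting_graph card_refls)
qed

lemma degree_refl:
  assumes "x \<in> refls"
  shows "degree_at \<Gamma> x = 2 * (n - center_size)"
proof -
  obtain j where j: "x = elt (True, j)"
    using assms by (auto simp: refls_def)
  let ?N = "{elt (True, i) |i. \<not> int n dvd 2 * (i - j)}"
  have "{y \<in> noncentral_rots \<union> refls. \<not> commute x y} = noncentral_rots \<union> {y \<in> refls. \<not> commute x y}"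
    using assms rot_refl_noncommute by blast
  also have "{y \<in> refls. \<not> commute x y} = ?N"
    unfolding j refls_def using commute_refl_refl by blast
  finally have "{y \<in> noncentral_rots \<union> refls. \<not> commute x y} = noncentral_rots \<union> ?N" .
  moreover have "?N \<subseteq> refls"
    by (auto simp: refls_def)
  then have "card (noncentral_rots \<union> ?N) = card noncentral_rots + card ?N"
    using rots_refls_disjoint finite_noncentral_rots finite_refls
    by (intro card_Un_disjoint) (auto intro: finite_subset)
  ultimately have "card {y \<in> noncentral_rots \<union> refls. \<not> commute x y} = 2 * (n - center_size)"
    using card_noncommuting_refls[of j] card_noncentral_rots by presburger
  then show ?thesis
    using assms by (simp add: degree_noncommuting_graph)
qed

text \<open>The vertex at distance 2 is the inverse, which is a different element because the rotation is
  not central. All vertices commuting with the rotation are themselves rotations, so any one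
  reflection serves as a common neighbour.\<close>

lemma eccentricity_rot:
  assumes "x \<in> noncentral_rots"
  shows "eccentricity \<Gamma> x = 2"
proof -
  obtain i where i: "x = elt (False, i)" "\<not> int n dvd 2 * i"
    using assms by (auto simp: noncentral_rots_def)
  have "\<not> int n dvd 2 * (- i)"
    using i(2) by simp
  then have y: "elt (False, - i) \<in> noncentral_rots"
    unfolding noncentral_rots_def by blast
  have neq: "elt (False, - i) \<noteq> x"
    using i(2) by (simp add: i(1) elt_eq_iff cong_iff_dvd_diff)
  have s: "elt (True, 0) \<in> refls"
    by (auto simp: refls_def)
  show ?thesis
  proof (rule eccentricity_noncommuting_graph_eq_2[of _ _ "elt (False, - i)"])
    fix v assume v: "v \<in> noncentral_rots \<union> refls" "commute x v"
    then have "v \<in> noncentral_rots"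
      using assms rot_refl_noncommute by blast
    then show "\<exists>w\<in>noncentral_rots \<union> refls. \<not> commute x w \<and> \<not> commute w v"
      using assms s rot_refl_noncommute by blast
  qed (use assms y neq rots_commute in auto)
qed

text \<open>For odd \<open>n\<close> a reflection commutes with no other vertex. For \<open>n = 2m\<close> it commutes with its
  product with the central rotation \<open>r\<^sup>m\<close>, and both are adjacent to \<open>r\<close>.\<close>

lemma eccentricity_refl:
  assumes "x \<in> refls"
  shows "eccentricity \<Gamma> x = center_size"
proof (cases "odd n")
  case True
  obtain i where i: "x = elt (True, i)"
    using assms by (auto simp: refls_def)
  have "eccentricity \<Gamma> x = 1"
  proof (rule eccentricity_noncommuting_graph_eq_1)
    show "noncentral_rots \<union> refls \<noteq> {x}"
    proof
      assume "noncentral_rots \<union> refls = {x}"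
      then have "elt (False, 1) = x"
        using r_in_noncentral_rots by blast
      then show False
        using r_in_noncentral_rots assms rots_refls_disjoint by blast
    qed
    fix v assume v: "v \<in> noncentral_rots \<union> refls" "v \<noteq> x"
    show "\<not> commute x v"
    proof (cases "v \<in> noncentral_rots")
      case False
      then obtain j where j: "v = elt (True, j)"
        using v by (auto simp: refls_def)
      have "coprime (int n) 2"
        using True by simp
      moreover have "\<not> int n dvd j - i"
        using v(2) by (simp add: i j elt_eq_iff cong_iff_dvd_diff)
      ultimately show ?thesis
        by (simp only: i j commute_refl_refl coprime_dvd_mult_right_iff not_False_eq_True)
    qed (use assms rot_refl_noncommute in blast)
  qed (use assms in simp)
  then show ?thesis
    using True by (simp add: center_size_def)
next
  case False
  obtain i where i: "x = elt (True, i)"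
    using assms by (auto simp: refls_def)
  obtain m where m: "n = 2 * m"
    using False by blast
  let ?y = "elt (True, i + int m)"
  have y: "?y \<in> refls"
    by (auto simp: refls_def)
  have "\<not> int n dvd int m"
    using m n_pos by (auto dest: zdvd_imp_le)
  then have neq: "?y \<noteq> x"
    by (simp add: i elt_eq_iff cong_iff_dvd_diff)
  have comm: "commute x ?y"
    unfolding i commute_refl_refl by (simp add: m)
  have "eccentricity \<Gamma> x = 2"
  proof (rule eccentricity_noncommuting_graph_eq_2[of _ _ ?y])
    fix v assume v: "v \<in> noncentral_rots \<union> refls" "commute x v"
    then have "v \<in> refls"
      using assms rot_refl_noncommute by blast
    then show "\<exists>w\<in>noncentral_rots \<union> refls. \<not> commute x w \<and> \<not> commute w v"
      using assms r_in_noncentral_rots rot_refl_noncommute by blast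
  qed (use assms y neq comm in auto)
  then show ?thesis
    using False by (simp add: center_size_def)
qed

lemma eccentric_connectivity_poly_eq:
  "eccentric_connectivity_poly \<Gamma> =
     monom (int (n - center_size) * int n) 2 +
     monom (int n * (2 * int (n - center_size))) center_size"
proof -
  have "eccentric_connectivity_poly \<Gamma> =
      (\<Sum>u\<in>noncentral_rots. monom (int n) 2) + (\<Sum>u\<in>refls. monom (2 * int (n - center_size)) center_size)"
    unfolding eccentric_connectivity_poly_def
    by (simp add: sum.union_disjoint finite_noncentral_rots finite_refls rots_refls_disjoint
        degree_rot degree_refl eccentricity_rot eccentricity_refl)
  then show ?thesis
    by (simp only: sum_const_monom card_noncentral_rots card_refls)
qed

lemma total_eccentricity_poly_eq:
  "total_eccentricity_poly \<Gamma> = monom (int (n - center_size)) 2 + monom (int n) center_size"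
proof -
  have "total_eccentricity_poly \<Gamma> =
      (\<Sum>u\<in>noncentral_rots. monom 1 2) + (\<Sum>u\<in>refls. monom 1 center_size)"
    unfolding total_eccentricity_poly_def
    by (simp add: sum.union_disjoint finite_noncentral_rots finite_refls rots_refls_disjoint
        eccentricity_rot eccentricity_refl)
  then show ?thesis
    by (simp only: sum_const_monom card_noncentral_rots card_refls mult_1_right)
qed

end

theorem theorem3p5:
  fixes n :: nat and \<Gamma> :: "dihedral_gen word set ugraph"
  assumes "n \<ge> 3"
    and "\<Gamma> = noncommuting_graph (dihedral_group n) (dihedral_Omega n)"
  shows "dihedral_Omega n = dihedral_Omega1 n \<union> dihedral_Omega2 n \<and>
    eccentric_connectivity_poly \<Gamma> =
      (if odd n then monom (int n * (int n - 1)) 2 + monom (2 * int n * (int n - 1)) 1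
       else monom (3 * int n * (int n - 2)) 2) \<and>
    total_eccentricity_poly \<Gamma> =
      (if odd n then monom (int n - 1) 2 + monom (int n) 1
       else monom (2 * (int n - 1)) 2)"
proof -
  interpret dihedral_ge_3 n
    using assms(1) by unfold_locales auto
  have \<Gamma>: "\<Gamma> = noncommuting_graph (dihedral_group n) (noncentral_rots \<union> refls)"
    by (simp add: assms Omega_eq)
  have "center_size \<le> n"
    using assms(1) by (simp add: center_size_def)
  then show ?thesis
    unfolding \<Gamma> eccentric_connectivity_poly_eq total_eccentricity_poly_eq
      Omega_eq[OF assms(1)] Omega1_eq[OF assms(1)] Omega2_eq
    by (auto simp: center_size_def of_nat_diff add_monom algebra_simps)
qed

end
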